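(* Let $p\in(0,1)$ be the deletion probability and $q=1-p$. Let $d\ge1$ and let $\mathbf{x},\mathbf{y}\in\{0,1\}^n$ be distinct strings with a block structure $$\mathbf{x}=\mathbf{x}_1\mathbf{x}_2\cdots\mathbf{x}_d,\qquad \mathbf{y}=\mathbf{y}_1\mathbf{y}_2\cdots\mathbf{y}_d,$$ where for each $i=1,\dots,d$, $\mathbf{x}_i$ and $\mathbf{y}_i$ are strings of the same length $\ell_i>0$, and each $i$ falls into one of the following cases: (1) $\mathbf{x}_i=\mathbf{y}_i$; (2) $\mathbf{x}_i=a_i\mathbf{s}_i$ and $\mathbf{y}_i=\mathbf{s}_ib_i$ for bits $a_i,b_i\in\{0,1\}$ and a string $\mathbf{s}_i$; (3) $\mathbf{x}_i=\mathbf{s}_ia_i$ and $\mathbf{y}_i=b_i\mathbf{s}_i$ for bits $a_i,b_i\in\{0,1\}$ and a string $\mathbf{s}_i$; (4) $\mathbf{x}_i=a_i\mathbf{s}_i$ and $\mathbf{y}_i=b_i\mathbf{s}_i$ for distinct bits $a_i,b_i\in\{0,1\}$ and a string $\mathbf{s}_i$; (5) $\mathbf{x}_i=\mathbf{s}_ia_i$ and $\mathbf{y}_i=\mathbf{s}_ib_i$ for distinct bits $a_i,b_i\in\{0,1\}$ and a string $\mathbf{s}_i$. Then $$\|\mathbf{E}(\mathbf{x})-\mathbf{E}(\mathbf{y})\|_{\ell_1}\ \ge\ \frac{q}{e}\left(\frac{q}{n}\right)^{3d}.$$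
   Context: Juxtaposition denotes concatenation of strings. Strings are indexed from $0$: $\mathbf{x}=x_0x_1\cdots x_{n-1}$. A trace $\tilde{\mathbf{x}}$ of $\mathbf{x}$ is the random subsequence obtained by deleting each bit of $\mathbf{x}$ independently with probability $p$, padded by $\tilde x_j=0$ for $j\ge|\tilde{\mathbf{x}}|$. The mean trace is $\mathbf{E}(\mathbf{x})=(E_0(\mathbf{x}),\dots,E_{n-1}(\mathbf{x}))$ with $E_j(\mathbf{x})=\mathbb{E}[\tilde x_j]$. The symbol $e$ is the base of the natural logarithm. *)

theory Defs
  imports "HOL-Probability.Probability"
begin

text \<open>
  Strings over \<open>{0,1}\<close> are lists of booleans, with \<open>True\<close> standing for the bit 1.
  In the trace distribution, \<open>del i\<close> says that position \<open>i\<close> is deleted.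
\<close>

definition trace_pmf :: "real \<Rightarrow> bool list \<Rightarrow> bool list pmf" where
  "trace_pmf p x =
     map_pmf (\<lambda>del. nths x {i. \<not> del i})
       (Pi_pmf {..<length x} False (\<lambda>_. bernoulli_pmf p))"

definition padded_bit :: "bool list \<Rightarrow> nat \<Rightarrow> real" where
  "padded_bit t j = (if j < length t then of_bool (t ! j) else 0)"

definition mean_trace :: "real \<Rightarrow> bool list \<Rightarrow> nat \<Rightarrow> real" where
  "mean_trace p x j = measure_pmf.expectation (trace_pmf p x) (\<lambda>t. padded_bit t j)"

definition l1_norm :: "nat \<Rightarrow> (nat \<Rightarrow> real) \<Rightarrow> real" where
  "l1_norm n v = (\<Sum>j<n. \<bar>v j\<bar>)"

definition block_pair :: "bool list \<Rightarrow> bool list \<Rightarrow> bool" where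
  "block_pair u v \<longleftrightarrow>
     u = v \<or>
     (\<exists>a b s. u = a # s \<and> v = s @ [b]) \<or>
     (\<exists>a b s. u = s @ [a] \<and> v = b # s) \<or>
     (\<exists>a b s. a \<noteq> b \<and> u = a # s \<and> v = b # s) \<or>
     (\<exists>a b s. a \<noteq> b \<and> u = s @ [a] \<and> v = s @ [b])"

end

theory Submission imports Defs begin

text \<open>
  Within each block the prefix sums \<open>A\<^sub>k\<close> of \<open>x - y\<close> are integers that take at most two
  consecutive values, hence do not change sign.  So there is a polynomial \<open>T\<close> of degree at most
  \<open>d - 1\<close>, a product of factors \<open>2c - 1 - 2k\<close> over block boundaries \<open>c\<close>, with
  \<open>T(k) A\<^sub>k \<ge> \<bar>A\<^sub>k\<bar>\<close> for all \<open>k < n\<close>; as \<open>x \<noteq> y\<close>, the sum of the \<open>T(k) A\<^sub>k\<close> is at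
  least 1.  Summation by parts makes this sum the pairing of \<open>x - y\<close> with a polynomial of degree
  at most \<open>d\<close>.  Since the \<open>r\<close>-th binomial moment of the mean trace is \<open>q ^ (r + 1)\<close> times
  that of the string, it is also the pairing of \<open>E(x) - E(y)\<close> with an explicit test function,
  whose supremum is at most \<open>2 n (4 n) ^ (d - 1) / q ^ (d + 1)\<close>.
\<close>

section \<open>Binomial moments of the mean trace\<close>

lemma trace_pmf_snoc:
  "trace_pmf p (x @ [b]) =
     do {t \<leftarrow> trace_pmf p x; c \<leftarrow> bernoulli_pmf p; return_pmf (if c then t else t @ [b])}"
proof -
  have nths_upd: "nths (x @ [b]) {i. \<not> (del(length x := c)) i} =
      (if c then nths x {i. \<not> del i} else nths x {i. \<not> del i} @ [b])" for del c
  proof -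
    have "nths x {i. \<not> (del(length x := c)) i} = nths x {i. \<not> del i}"
      unfolding nths_def
      by (intro arg_cong[where f = "map fst"] filter_cong) (auto dest!: set_zip_rightD)
    then show ?thesis
      by (auto simp: nths_append)
  qed
  have "trace_pmf p (x @ [b]) =
      do {c \<leftarrow> bernoulli_pmf p; t \<leftarrow> trace_pmf p x; return_pmf (if c then t else t @ [b])}"
    by (simp add: trace_pmf_def lessThan_Suc Pi_pmf_insert' map_pmf_def bind_assoc_pmf
        bind_return_pmf nths_upd del: fun_upd_apply)
  then show ?thesis
    by (simp add: bind_commute_pmf[of "bernoulli_pmf p"])
qed

lemma finite_set_trace_pmf: "finite (set_pmf (trace_pmf p x))"
proof (induction x rule: rev_induct)
  case Nil
  show ?case by (simp add: trace_pmf_def)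
next
  case (snoc b x)
  then show ?case by (auto simp: trace_pmf_snoc)
qed

lemma integrable_trace_pmf: "integrable (measure_pmf (trace_pmf p x)) (f :: bool list \<Rightarrow> real)"
  by (simp add: finite_set_trace_pmf integrable_measure_pmf_finite)

lemma length_le_trace_pmf: "t \<in> set_pmf (trace_pmf p x) \<Longrightarrow> length t \<le> length x"
proof (induction x arbitrary: t rule: rev_induct)
  case Nil
  then show ?case by (simp add: trace_pmf_def)
next
  case (snoc b x)
  then show ?case by (fastforce simp: trace_pmf_snoc split: if_splits)
qed

lemma expectation_trace_pmf_snoc:
  fixes f :: "bool list \<Rightarrow> real"
  assumes "0 \<le> p" "p \<le> 1"
  shows "measure_pmf.expectation (trace_pmf p (x @ [b])) f =
    p * measure_pmf.expectation (trace_pmf p x) f +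
    (1 - p) * measure_pmf.expectation (trace_pmf p x) (\<lambda>t. f (t @ [b]))"
proof -
  let ?S = "set_pmf (trace_pmf p x)"
  have "measure_pmf.expectation (trace_pmf p (x @ [b])) f =
      (\<Sum>t\<in>?S. pmf (trace_pmf p x) t *\<^sub>R measure_pmf.expectation
         (bernoulli_pmf p \<bind> (\<lambda>c. return_pmf (if c then t else t @ [b]))) f)"
    unfolding trace_pmf_snoc
    by (rule pmf_expectation_bind[OF finite_set_trace_pmf]) auto
  also have "\<dots> = (\<Sum>t\<in>?S. pmf (trace_pmf p x) t * (p * f t + (1 - p) * f (t @ [b])))"
    using assms by (simp add: mult.commute flip: map_pmf_def)
  also have "\<dots> = measure_pmf.expectation (trace_pmf p x) (\<lambda>t. p * f t + (1 - p) * f (t @ [b]))"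
    by (subst integral_measure_pmf[OF finite_set_trace_pmf]) auto
  finally show ?thesis
    by (simp add: integrable_trace_pmf)
qed

text \<open>Pascal's rule: a surviving last bit adds the moment of order \<open>r - 1\<close> to
  that of order \<open>r\<close>. This is why the induction keeps \<open>r\<close>
  arbitrary.\<close>

lemma expectation_length_choose:
  assumes "0 \<le> p" "p \<le> 1"
  shows "measure_pmf.expectation (trace_pmf p x) (\<lambda>t. real (length t choose r)) =
    (1 - p) ^ r * real (length x choose r)"
proof (induction x arbitrary: r rule: rev_induct)
  case Nil
  show ?case by (cases r) (simp_all add: trace_pmf_def)
next
  case (snoc b x)
  show ?case
  proof (cases r)
    case 0
    then show ?thesis by simp
  next
    case (Suc s)
    show ?thesis
      using assms by (simp add: expectation_trace_pmf_snoc Suc integrable_trace_pmf snoc.IH)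
        (simp add: algebra_simps)
  qed
qed

text \<open>A bit at position \<open>k\<close> survives with probability \<open>1 - p\<close>, and
  its new position is the independent number of survivors among the \<open>k\<close> earlier bits,
  with \<open>r\<close>-th binomial moment \<open>(1 - p) ^ r * (k choose r)\<close>. Appending bits
  one by one collects these contributions.\<close>

lemma expectation_trace_moment:
  assumes "0 \<le> p" "p \<le> 1"
  shows "measure_pmf.expectation (trace_pmf p x)
      (\<lambda>t. \<Sum>j<length t. real (j choose r) * of_bool (t ! j)) =
    (1 - p) ^ Suc r * (\<Sum>k<length x. real (k choose r) * of_bool (x ! k))"
proof -
  define G :: "bool list \<Rightarrow> real"
    where "G t = (\<Sum>j<length t. real (j choose r) * of_bool (t ! j))" for t
  have G_snoc: "G (t @ [b]) = G t + real (length t choose r) * of_bool b" for t b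
    unfolding G_def by (simp add: nth_append del: sum_mult_of_bool_eq)
  have "measure_pmf.expectation (trace_pmf p x) G = (1 - p) ^ Suc r * G x"
  proof (induction x rule: rev_induct)
    case Nil
    show ?case by (simp add: trace_pmf_def G_def)
  next
    case (snoc b x)
    show ?case
      by (simp add: expectation_trace_pmf_snoc[OF assms] G_snoc integrable_trace_pmf
          expectation_length_choose[OF assms] snoc.IH)
        (simp add: algebra_simps)
  qed
  then show ?thesis
    by (simp only: G_def[abs_def])
qed

lemma mean_trace_moment:
  assumes "0 \<le> p" "p \<le> 1"
  shows "(\<Sum>j<length x. real (j choose r) * mean_trace p x j) =
    (1 - p) ^ Suc r * (\<Sum>k<length x. real (k choose r) * of_bool (x ! k))"
proof -
  have "(\<Sum>j<length x. real (j choose r) * mean_trace p x j) =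
      measure_pmf.expectation (trace_pmf p x)
        (\<lambda>t. \<Sum>j<length x. real (j choose r) * padded_bit t j)"
    by (simp add: mean_trace_def integrable_trace_pmf)
  \<comment> \<open>Positions beyond the trace carry the padding 0, and no trace is longer than
    \<open>x\<close>, so the two ranges of summation give the same value.\<close>
  also have "\<dots> = measure_pmf.expectation (trace_pmf p x)
      (\<lambda>t. \<Sum>j<length t. real (j choose r) * of_bool (t ! j))"
  proof (intro integral_cong_AE AE_pmfI)
    fix t assume "t \<in> set_pmf (trace_pmf p x)"
    then have "length t \<le> length x" by (rule length_le_trace_pmf)
    then show "(\<Sum>j<length x. real (j choose r) * padded_bit t j) =
        (\<Sum>j<length t. real (j choose r) * of_bool (t ! j))"
      by (intro sum.mono_neutral_cong_right) (auto simp: padded_bit_def)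
  qed auto
  finally show ?thesis
    by (simp only: expectation_trace_moment[OF assms])
qed

section \<open>Polynomials in the binomial basis\<close>

lemma mult_binomial:
  "real k * real (k choose r) = real r * real (k choose r) + real (Suc r) * real (k choose Suc r)"
proof (cases "r \<le> k")
  case True
  have "Suc r * (k choose Suc r) = (k - r) * (k choose r)"
    by (simp only: binomial_absorption binomial_absorb_comp)
  then have "real (Suc r) * real (k choose Suc r) = (real k - real r) * real (k choose r)"
    using True by (metis of_nat_diff of_nat_mult)
  then show ?thesis by (simp only: left_diff_distrib)
qed (simp add: binomial_eq_0)

lemma binomial_le_power_div_fact: "real (n choose r) \<le> real n ^ r / fact r"
proof -
  have "real ((n choose r) * fact r) \<le> real (n ^ r)"
    by (rule of_nat_mono[OF binomial_fact_pow])
  then show ?thesis by (simp add: pos_le_divide_eq)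
qed

lemma sum_choose_lessThan: "(\<Sum>j<k. j choose r) = k choose Suc r"
  by (induction k) simp_all

text \<open>The binomial basis is chosen because passing from a string to its mean trace is diagonal
  in it: each moment is just scaled by a power of \<open>1 - p\<close>.\<close>

definition binomial_poly :: "(nat \<Rightarrow> real) \<Rightarrow> nat \<Rightarrow> nat \<Rightarrow> real" where
  "binomial_poly a m k = (\<Sum>r\<le>m. a r * real (k choose r))"

text \<open>The weights \<open>n ^ r / fact r\<close> bound the binomial coefficients \<open>j choose r\<close> for \<open>j \<le> n\<close>.\<close>

definition binomial_weight :: "nat \<Rightarrow> (nat \<Rightarrow> real) \<Rightarrow> nat \<Rightarrow> real" where
  "binomial_weight n a m = (\<Sum>r\<le>m. \<bar>a r\<bar> * (real n ^ r / fact r))"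

lemma binomial_poly_extend: "binomial_poly (a(Suc m := 0)) (Suc m) = binomial_poly a m"
  by (auto simp: binomial_poly_def fun_eq_iff)

lemma binomial_weight_extend: "binomial_weight n (a(Suc m := 0)) (Suc m) = binomial_weight n a m"
  by (auto simp: binomial_weight_def)

text \<open>By \<open>mult_binomial\<close>, the coefficient \<open>a r\<close> contributes
  \<open>(c - 2 * r) * a r\<close> at index \<open>r\<close> and \<open>- 2 * (r + 1) * a r\<close>
  at index \<open>r + 1\<close>. Each of the two kinds costs a factor of at most
  \<open>2 * n\<close> in weight; for the second, the \<open>r + 1\<close> cancels against the
  factorial.\<close>

lemma binomial_poly_mult_linear:
  assumes "\<And>r. r \<le> m \<Longrightarrow> \<bar>c - 2 * real r\<bar> \<le> 2 * real n"
  obtains a' where "\<And>k. binomial_poly a' (Suc m) k = (c - 2 * real k) * binomial_poly a m k"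
    and "binomial_weight n a' (Suc m) \<le> 4 * real n * binomial_weight n a m"
proof
  define u where "u = (\<lambda>r. if r \<le> m then (c - 2 * real r) * a r else 0)"
  \<comment> \<open>At \<open>r = 0\<close> the truncated \<open>r - 1\<close> is harmless, since
    the factor \<open>r\<close> vanishes.\<close>
  define v where "v = (\<lambda>r. 2 * real r * a (r - 1))"
  let ?a' = "\<lambda>r. u r - v r"
  show "binomial_poly ?a' (Suc m) k = (c - 2 * real k) * binomial_poly a m k" for k
  proof -
    have "binomial_poly ?a' (Suc m) k =
        (\<Sum>r\<le>Suc m. u r * real (k choose r)) - (\<Sum>r\<le>Suc m. v r * real (k choose r))"
      by (simp only: binomial_poly_def left_diff_distrib sum_subtractf)
    also have "(\<Sum>r\<le>Suc m. u r * real (k choose r)) =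
        (\<Sum>r\<le>m. (c - 2 * real r) * a r * real (k choose r))"
      by (simp add: u_def)
    also have "(\<Sum>r\<le>Suc m. v r * real (k choose r)) =
        (\<Sum>r\<le>m. 2 * a r * (real (Suc r) * real (k choose Suc r)))"
      by (subst sum.atMost_Suc_shift) (simp add: v_def mult.assoc mult.left_commute del: of_nat_Suc)
    also have "\<dots> = (\<Sum>r\<le>m. 2 * a r * (real k * real (k choose r) - real r * real (k choose r)))"
      by (simp only: mult_binomial add_diff_cancel_left')
    finally show ?thesis
      by (simp add: binomial_poly_def sum_distrib_left flip: sum_subtractf) (simp add: algebra_simps)
  qed
  have "binomial_weight n ?a' (Suc m) \<le>
      (\<Sum>r\<le>Suc m. \<bar>u r\<bar> * (real n ^ r / fact r)) + (\<Sum>r\<le>Suc m. \<bar>v r\<bar> * (real n ^ r / fact r))"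
    unfolding binomial_weight_def sum.distrib[symmetric] distrib_right[symmetric]
    by (intro sum_mono mult_right_mono abs_triangle_ineq4) simp
  also have "(\<Sum>r\<le>Suc m. \<bar>u r\<bar> * (real n ^ r / fact r)) \<le> 2 * real n * binomial_weight n a m"
  proof -
    have "(\<Sum>r\<le>Suc m. \<bar>u r\<bar> * (real n ^ r / fact r)) =
        (\<Sum>r\<le>m. \<bar>c - 2 * real r\<bar> * (\<bar>a r\<bar> * (real n ^ r / fact r)))"
      by (simp add: u_def abs_mult mult.assoc)
    also have "\<dots> \<le> (\<Sum>r\<le>m. 2 * real n * (\<bar>a r\<bar> * (real n ^ r / fact r)))"
      using assms by (intro sum_mono mult_right_mono) auto
    finally show ?thesis by (simp only: binomial_weight_def sum_distrib_left)
  qed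
  also have "(\<Sum>r\<le>Suc m. \<bar>v r\<bar> * (real n ^ r / fact r)) = 2 * real n * binomial_weight n a m"
  proof -
    have "(\<Sum>r\<le>Suc m. \<bar>v r\<bar> * (real n ^ r / fact r)) =
        (\<Sum>r\<le>m. 2 * real (Suc r) * \<bar>a r\<bar> * (real n ^ Suc r / fact (Suc r)))"
      by (subst sum.atMost_Suc_shift) (simp add: v_def abs_mult del: of_nat_Suc fact_Suc power_Suc)
    also have "\<dots> = (\<Sum>r\<le>m. 2 * real n * (\<bar>a r\<bar> * (real n ^ r / fact r)))"
      by (intro sum.cong refl) (simp add: fact_Suc del: of_nat_Suc)
    finally show ?thesis by (simp only: binomial_weight_def sum_distrib_left)
  qed
  finally show "binomial_weight n ?a' (Suc m) \<le> 4 * real n * binomial_weight n a m"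
    by simp
qed

text \<open>The last interval is unbounded, so the induction step only has to split it at the new
  boundary. If the sign changes there, one more linear factor is multiplied in; otherwise the
  polynomial is kept and padded with a zero coefficient.\<close>

lemma exists_binomial_poly_signs:
  fixes c :: "nat \<Rightarrow> nat" and s :: "nat \<Rightarrow> real"
  assumes "mono c" "\<And>i. c i \<le> n" "m \<le> n" "\<And>i. s i = 1 \<or> s i = - 1"
  shows "\<exists>a. binomial_weight n a m \<le> (4 * real n) ^ m \<and>
    (\<forall>i\<le>m. \<forall>k\<ge>c i. (i < m \<longrightarrow> k < c (Suc i)) \<longrightarrow> s i * binomial_poly a m k \<ge> 1)"
  using assms(3)
proof (induction m)
  case 0
  show ?case
    using assms(4)[of 0]
    by (intro exI[of _ "\<lambda>_. s 0"]) (auto simp: binomial_weight_def binomial_poly_def)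
next
  case (Suc m)
  then obtain a where w: "binomial_weight n a m \<le> (4 * real n) ^ m"
    and a: "\<And>i k. i \<le> m \<Longrightarrow> c i \<le> k \<Longrightarrow> (i < m \<longrightarrow> k < c (Suc i)) \<Longrightarrow> s i * binomial_poly a m k \<ge> 1"
    by auto
  show ?case
  proof (cases "s (Suc m) = s m")
    case True
    have "n \<ge> 1" using Suc.prems by simp
    then have "(4 * real n) ^ m * 1 \<le> (4 * real n) ^ m * (4 * real n)"
      by (intro mult_left_mono) auto
    then have "binomial_weight n (a(Suc m := 0)) (Suc m) \<le> (4 * real n) ^ Suc m"
      using w by (simp add: binomial_weight_extend mult.commute)
    moreover have "s i * binomial_poly a m k \<ge> 1"
      if "i \<le> Suc m" "c i \<le> k" "i < Suc m \<longrightarrow> k < c (Suc i)" for i k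
    proof (cases "i = Suc m")
      case True
      have "c m \<le> k" using that True monoD[OF \<open>mono c\<close>, of m "Suc m"] by simp
      then show ?thesis using a[of m k] True \<open>s (Suc m) = s m\<close> by simp
    next
      case False
      then show ?thesis using that a[of i k] by simp
    qed
    ultimately show ?thesis
      by (intro exI[of _ "a(Suc m := 0)"]) (simp add: binomial_poly_extend del: fun_upd_apply)
  next
    case False
    then have s: "s (Suc m) = - s m" using assms(4)[of m] assms(4)[of "Suc m"] by auto
    \<comment> \<open>The root of \<open>C - 2 * k\<close> lies half a unit below the boundary. At
      integers \<open>k\<close> the factor is odd, hence of modulus at least 1, positive before the
      boundary and negative from it on.\<close>
    define C where "C = 2 * real (c (Suc m)) - 1"
    \<comment> \<open>The upper bound comes from \<open>c (Suc m) \<le> n\<close>, the lower one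
      from \<open>r < n\<close>, which is where \<open>Suc m \<le> n\<close> enters.\<close>
    have "\<bar>C - 2 * real r\<bar> \<le> 2 * real n" if "r \<le> m" for r
      using that Suc.prems assms(2)[of "Suc m"] by (simp add: C_def abs_le_iff)
    then obtain a' where a': "\<And>k. binomial_poly a' (Suc m) k = (C - 2 * real k) * binomial_poly a m k"
      and w': "binomial_weight n a' (Suc m) \<le> 4 * real n * binomial_weight n a m"
      using binomial_poly_mult_linear[of m C n a] by blast
    have "binomial_weight n a' (Suc m) \<le> (4 * real n) ^ Suc m"
      using w' mult_left_mono[OF w, of "4 * real n"] by simp
    moreover have "s i * binomial_poly a' (Suc m) k \<ge> 1"
      if i: "i \<le> Suc m" "c i \<le> k" "i < Suc m \<longrightarrow> k < c (Suc i)" for i k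
    proof -
      have prod_ge: "1 \<le> y * z" if "1 \<le> y" "1 \<le> z" for y z :: real
        using mult_mono[OF that] that by simp
      show ?thesis
      proof (cases "i = Suc m")
        case True
        have "c m \<le> k" using i True monoD[OF \<open>mono c\<close>, of m "Suc m"] by simp
        then have "s m * binomial_poly a m k \<ge> 1" using a[of m k] by simp
        moreover have "2 * real k - C \<ge> 1" using i True by (simp add: C_def)
        ultimately have "1 \<le> (2 * real k - C) * (s m * binomial_poly a m k)"
          by (rule prod_ge[rotated])
        then show ?thesis by (simp add: a' True s algebra_simps)
      next
        case False
        then have "k < c (Suc i)" "i \<le> m" using i by auto
        moreover from this have "c (Suc i) \<le> c (Suc m)" using monoD[OF \<open>mono c\<close>] by simp
        ultimately have "real k + 1 \<le> real (c (Suc m))" by linarith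
        then have "C - 2 * real k \<ge> 1" by (simp add: C_def)
        moreover have "s i * binomial_poly a m k \<ge> 1"
          using a[of i k] i \<open>i \<le> m\<close> \<open>k < c (Suc i)\<close> by simp
        ultimately have "1 \<le> (C - 2 * real k) * (s i * binomial_poly a m k)"
          by (rule prod_ge)
        then show ?thesis by (simp add: a' algebra_simps)
      qed
    qed
    ultimately show ?thesis by (intro exI[of _ a']) simp
  qed
qed

section \<open>Prefix sums of the difference and their signs on blocks\<close>

definition prefix_diff :: "bool list \<Rightarrow> bool list \<Rightarrow> nat \<Rightarrow> int" where
  "prefix_diff u v k = (\<Sum>j<k. of_bool (u ! j) - of_bool (v ! j))"

lemma prefix_diff_swap: "prefix_diff u v k = - prefix_diff v u k"
  by (simp add: prefix_diff_def flip: sum_negf)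

text \<open>The first \<open>m\<close> bits of \<open>s\<close> occur in both prefixes and cancel,
  leaving one bit on each side.\<close>

lemma prefix_diff_rotate:
  assumes "m \<le> length s"
  shows "prefix_diff (a # s) (s @ [b]) (Suc m) = of_bool a - of_bool ((s @ [b]) ! m)"
proof -
  have "(\<Sum>j<m. of_bool ((s @ [b]) ! j) :: int) = (\<Sum>j<m. of_bool (s ! j))"
    using assms by (intro sum.cong) (auto simp: nth_append)
  then show ?thesis
    unfolding prefix_diff_def sum_subtractf
    by (subst sum.lessThan_Suc_shift) simp
qed

text \<open>For shifted blocks the prefix difference is a fixed bit minus a varying one, up to an
  overall sign, so the fixed bit alone decides the direction. For substituted bits it is either 0 or
  the constant \<open>a - b\<close>.\<close>

lemma block_pair_prefix_sign:
  assumes "block_pair u v"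
  shows "\<exists>e\<in>{1, -1}. \<forall>m<length u. e * prefix_diff u v (Suc m) \<in> {0, 1}"
proof -
  consider "u = v" | a b s where "u = a # s" "v = s @ [b]" | a b s where "u = s @ [a]" "v = b # s"
    | a b s where "a \<noteq> b" "u = a # s" "v = b # s"
    | a b s where "a \<noteq> b" "u = s @ [a]" "v = s @ [b]"
    using assms unfolding block_pair_def by metis
  then show ?thesis
  proof cases
    case 1
    then show ?thesis by (intro bexI[of _ 1]) (auto simp: prefix_diff_def)
  next
    case (2 a b s)
    then show ?thesis
      by (intro bexI[of _ "if a then 1 else -1"]) (auto simp: prefix_diff_rotate)
  next
    case (3 a b s)
    then show ?thesis
      unfolding prefix_diff_swap[of u v]
      by (intro bexI[of _ "if b then -1 else 1"]) (auto simp: prefix_diff_rotate)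
  next
    case (4 a b s)
    then have "prefix_diff u v (Suc m) = of_bool a - of_bool b" for m
      unfolding prefix_diff_def by (subst sum.lessThan_Suc_shift) simp
    then show ?thesis
      by (intro bexI[of _ "if a then 1 else -1"]) (auto simp: 4)
  next
    case (5 a b s)
    have "prefix_diff u v (Suc m) = (if m = length s then of_bool a - of_bool b else 0)"
      if "m < length u" for m
      using that by (auto simp: 5 prefix_diff_def nth_append)
    then show ?thesis
      using \<open>a \<noteq> b\<close> by (intro bexI[of _ "if a then 1 else -1"]) auto
  qed
qed

lemma concat_nth_block:
  assumes "i < length xs" "j < length (xs ! i)"
  shows "concat xs ! (length (concat (take i xs)) + j) = xs ! i ! j"
proof -
  have "concat xs = concat (take i xs) @ xs ! i @ concat (drop (Suc i) xs)"
    by (metis assms(1) concat.simps(2) concat_append id_take_nth_drop)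
  then show ?thesis using assms(2) by (simp only: nth_append_length_plus nth_append_left)
qed

lemma length_concat_take_cong:
  assumes "length xs = length ys" "\<And>i. i < length xs \<Longrightarrow> length (xs ! i) = length (ys ! i)"
  shows "length (concat (take i xs)) = length (concat (take i ys))"
proof -
  have "map length (take i xs) = map length (take i ys)"
    using assms by (intro nth_equalityI) auto
  then show ?thesis by (simp only: length_concat)
qed

lemma prefix_diff_concat:
  assumes "length xs = length ys" "\<And>i. i < length xs \<Longrightarrow> length (xs ! i) = length (ys ! i)"
    and "i < length xs" "k \<le> length (xs ! i)"
  defines "c \<equiv> length (concat (take i xs))"
  shows "prefix_diff (concat xs) (concat ys) (c + k) =
    prefix_diff (concat xs) (concat ys) c + prefix_diff (xs ! i) (ys ! i) k"
  using assms(4)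
proof (induction k)
  case 0
  show ?case by (simp add: prefix_diff_def)
next
  case (Suc k)
  have c': "c = length (concat (take i ys))"
    unfolding c_def using assms(1,2) by (rule length_concat_take_cong)
  have "concat xs ! (c + k) = xs ! i ! k"
    unfolding c_def using Suc.prems assms(3) by (intro concat_nth_block) auto
  moreover have "concat ys ! (c + k) = ys ! i ! k"
    unfolding c' using Suc.prems assms(1,2,3) by (intro concat_nth_block) auto
  moreover have "prefix_diff u v (Suc m) = prefix_diff u v m + (of_bool (u ! m) - of_bool (v ! m))"
    for u v m
    by (simp add: prefix_diff_def)
  ultimately show ?case
    using Suc by simp
qed

text \<open>Inside a block the prefix sum is its value at the block's start plus 0 or one fixed
  unit. A nonzero integer cannot cross zero by a unit step, and from zero the sum moves in only one
  direction.\<close>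

lemma prefix_diff_concat_sign:
  assumes "length xs = length ys" "\<And>i. i < length xs \<Longrightarrow> length (xs ! i) = length (ys ! i)"
    and "i < length xs" "block_pair (xs ! i) (ys ! i)"
  shows "\<exists>s::real. (s = 1 \<or> s = -1) \<and>
    (\<forall>k\<ge>length (concat (take i xs)). k < length (concat (take (Suc i) xs)) \<longrightarrow>
       s * real_of_int (prefix_diff (concat xs) (concat ys) (Suc k)) \<ge> 0)"
proof -
  define c where "c = length (concat (take i xs))"
  define A where "A = prefix_diff (concat xs) (concat ys) c"
  obtain e :: int where e: "e \<in> {1, -1}"
    and pe: "\<And>m. m < length (xs ! i) \<Longrightarrow> e * prefix_diff (xs ! i) (ys ! i) (Suc m) \<in> {0, 1}"
    using block_pair_prefix_sign[OF assms(4)] by blast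
  define s :: int where "s = (if A = 0 then e else sgn A)"
  have s: "s = 1 \<or> s = -1" using e by (auto simp: s_def sgn_if)
  have "s * prefix_diff (concat xs) (concat ys) (Suc k) \<ge> 0"
    if k: "c \<le> k" "k < length (concat (take (Suc i) xs))" for k
  proof -
    have m: "k - c < length (xs ! i)"
      using k assms(3) by (simp add: c_def take_Suc_conv_app_nth)
    have "prefix_diff (concat xs) (concat ys) (c + Suc (k - c)) =
        A + prefix_diff (xs ! i) (ys ! i) (Suc (k - c))"
      unfolding A_def c_def
      by (rule prefix_diff_concat[OF assms(1) assms(2) assms(3)]) (use m in \<open>simp_all add: c_def\<close>)
    moreover have "c + Suc (k - c) = Suc k" using k by simp
    ultimately have "prefix_diff (concat xs) (concat ys) (Suc k) =
        A + prefix_diff (xs ! i) (ys ! i) (Suc (k - c))"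
      by (simp only:)
    moreover define B where "B = prefix_diff (xs ! i) (ys ! i) (Suc (k - c))"
    moreover have "s * (A + B) \<ge> 0"
    proof -
      have B: "e * B \<in> {0, 1}" using pe[OF m] by (simp only: B_def)
      consider "A = 0" | "A \<ge> 1" | "A \<le> -1" by linarith
      then show ?thesis
      proof cases
        case 1
        then show ?thesis using B by (auto simp: s_def)
      next
        case 2
        then show ?thesis using B e by (auto simp: s_def)
      next
        case 3
        then show ?thesis using B e by (auto simp: s_def)
      qed
    qed
    ultimately show ?thesis by simp
  qed
  then have "real_of_int s * real_of_int (prefix_diff (concat xs) (concat ys) (Suc k)) \<ge> 0"
    if "c \<le> k" "k < length (concat (take (Suc i) xs))" for k
    using that by (simp only: of_int_mult[symmetric] of_int_0_le_iff)
  moreover have "real_of_int s = 1 \<or> real_of_int s = -1" using s by auto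
  ultimately show ?thesis
    unfolding c_def by blast
qed

lemma prefix_diff_nonzero:
  assumes "length x = n" "length y = n" "x \<noteq> y"
  obtains k where "k < n" "prefix_diff x y (Suc k) \<noteq> 0"
proof -
  define P where "P = (\<lambda>k. k < n \<and> x ! k \<noteq> y ! k)"
  \<comment> \<open>At the first disagreement all earlier terms vanish, so the prefix sum is a
    single difference of distinct bits.\<close>
  define k where "k = Least P"
  have "\<exists>k. P k"
  proof (rule ccontr)
    assume "\<not> (\<exists>k. P k)"
    then have "x = y" using assms(1,2) by (intro nth_equalityI) (auto simp: P_def)
    with assms(3) show False ..
  qed
  then have "P k" unfolding k_def by (rule LeastI_ex)
  then have k: "k < n" "x ! k \<noteq> y ! k" by (auto simp: P_def)
  have "x ! j = y ! j" if "j < k" for j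
  proof -
    have "\<not> P j" using that unfolding k_def by (rule not_less_Least)
    with that k(1) show ?thesis by (simp add: P_def)
  qed
  then have "(\<Sum>j<k. of_bool (x ! j) - of_bool (y ! j) :: int) = 0"
    by (intro sum.neutral) auto
  then have "prefix_diff x y (Suc k) = of_bool (x ! k) - of_bool (y ! k)"
    by (simp only: prefix_diff_def sum.lessThan_Suc)
  moreover have "of_bool (x ! k) - of_bool (y ! k) \<noteq> (0 :: int)"
    using k(2) by (cases "x ! k"; cases "y ! k") simp_all
  ultimately show ?thesis using that[of k] k(1) by (simp only: not_False_eq_True)
qed

section \<open>Duality between prefix sums and mean traces\<close>

text \<open>Both sides sum \<open>D k * T j\<close> over \<open>k \<le> j < n\<close>. Taking the
  antidifference that vanishes at \<open>n\<close> avoids a boundary term.\<close>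

lemma summation_by_parts_upper:
  fixes D T :: "nat \<Rightarrow> real"
  shows "(\<Sum>k<n. D k * ((\<Sum>j<n. T j) - (\<Sum>j<k. T j))) = (\<Sum>j<n. T j * (\<Sum>k<Suc j. D k))"
proof (induction n)
  case (Suc n)
  have "(\<Sum>k<Suc n. D k * ((\<Sum>j<Suc n. T j) - (\<Sum>j<k. T j))) =
      (\<Sum>k<n. D k * ((\<Sum>j<n. T j) - (\<Sum>j<k. T j)) + T n * D k) + T n * D n"
    by (simp add: algebra_simps)
  also have "\<dots> = (\<Sum>k<n. D k * ((\<Sum>j<n. T j) - (\<Sum>j<k. T j))) + T n * (\<Sum>k<Suc n. D k)"
    by (simp add: sum.distrib sum_distrib_left distrib_left)
  finally show ?case by (simp add: Suc.IH)
qed simp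

lemma mean_trace_diff_moment:
  assumes "0 \<le> p" "p \<le> 1" "length x = n" "length y = n"
  shows "(\<Sum>j<n. real (j choose r) * (mean_trace p x j - mean_trace p y j)) =
    (1 - p) ^ Suc r * (\<Sum>k<n. real (k choose r) * (of_bool (x ! k) - of_bool (y ! k)))"
  using mean_trace_moment[OF assms(1,2), of r x] mean_trace_moment[OF assms(1,2), of r y] assms(3,4)
  by (simp only: right_diff_distrib sum_subtractf)

text \<open>Summation by parts raises the degree to \<open>m + 1\<close>, and the moment of that
  order is scaled by \<open>q ^ (m + 2)\<close>; undoing the scaling gives the power of
  \<open>q\<close> in the bound. The rest is the pairing of the l1 norm with the supremum of
  \<open>g\<close>.\<close>

lemma prefix_pairing_le_l1_norm:
  assumes p: "0 \<le> p" "p < 1" and len: "length x = n" "length y = n"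
  defines "q \<equiv> 1 - p"
  shows "(\<Sum>j<n. binomial_poly a m j * real_of_int (prefix_diff x y (Suc j))) \<le>
    2 * real n / q ^ (m + 2) * binomial_weight n a m *
      l1_norm n (\<lambda>j. mean_trace p x j - mean_trace p y j)"
proof -
  have q: "0 < q" "q \<le> 1" using p by (auto simp: q_def)
  define E where "E = (\<lambda>j. mean_trace p x j - mean_trace p y j)"
  define D where "D = (\<lambda>k. of_bool (x ! k) - of_bool (y ! k) :: real)"
  \<comment> \<open>Rescale the binomial coefficients of the antidifference that vanishes at \<open>n\<close>.\<close>
  define g where "g = (\<lambda>j. \<Sum>r\<le>m. a r * (real (n choose Suc r) / q - real (j choose Suc r) / q ^ (r + 2)))"
  have moment: "(\<Sum>j<n. real (j choose r) * E j) = q ^ Suc r * (\<Sum>k<n. real (k choose r) * D k)" for r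
    unfolding E_def D_def q_def using p len by (intro mean_trace_diff_moment) auto
  have antidiff: "(\<Sum>j<k. binomial_poly a m j) = (\<Sum>r\<le>m. a r * real (k choose Suc r))" for k
  proof -
    have "(\<Sum>j<k. binomial_poly a m j) = (\<Sum>r\<le>m. a r * real (\<Sum>j<k. j choose r))"
      unfolding binomial_poly_def by (subst sum.swap) (simp add: sum_distrib_left)
    then show ?thesis by (simp only: sum_choose_lessThan)
  qed
  have "(\<Sum>j<n. binomial_poly a m j * real_of_int (prefix_diff x y (Suc j))) =
      (\<Sum>k<n. D k * ((\<Sum>j<n. binomial_poly a m j) - (\<Sum>j<k. binomial_poly a m j)))"
    unfolding summation_by_parts_upper by (simp add: prefix_diff_def D_def)
  also have "\<dots> = (\<Sum>k<n. \<Sum>r\<le>m. D k * (a r * (real (n choose Suc r) - real (k choose Suc r))))"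
    by (simp only: antidiff sum_distrib_left right_diff_distrib flip: sum_subtractf)
  also have "\<dots> = (\<Sum>r\<le>m. \<Sum>k<n. D k * (a r * (real (n choose Suc r) - real (k choose Suc r))))"
    by (rule sum.swap)
  also have "\<dots> = (\<Sum>r\<le>m. a r * (real (n choose Suc r) * (\<Sum>k<n. D k)
      - (\<Sum>k<n. real (k choose Suc r) * D k)))"
    by (intro sum.cong refl)
      (simp only: sum_distrib_left right_diff_distrib sum_subtractf, simp only: mult_ac)
  \<comment> \<open>The term \<open>n choose Suc r\<close> is constant in \<open>k\<close>, so it is
    paired with the moment of order 0 and costs only \<open>1 / q\<close>; the other term needs the
    moment of order \<open>Suc r\<close>.\<close>
  also have "\<dots> = (\<Sum>r\<le>m. a r * (real (n choose Suc r) / q * (\<Sum>j<n. E j)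
      - (\<Sum>j<n. real (j choose Suc r) * E j) / q ^ (r + 2)))"
    using moment[of 0] moment q by (intro sum.cong refl) simp
  also have "\<dots> = (\<Sum>r\<le>m. \<Sum>j<n. a r * (real (n choose Suc r) / q - real (j choose Suc r) / q ^ (r + 2)) * E j)"
    by (intro sum.cong refl)
      (simp only: sum_distrib_left sum_divide_distrib left_diff_distrib right_diff_distrib
        times_divide_eq_left times_divide_eq_right mult.assoc flip: sum_subtractf)
  also have "\<dots> = (\<Sum>j<n. g j * E j)"
    by (subst sum.swap) (simp only: g_def sum_distrib_right)
  also have "\<dots> \<le> (\<Sum>j<n. 2 * real n / q ^ (m + 2) * binomial_weight n a m * \<bar>E j\<bar>)"
  proof (rule sum_mono)
    fix j assume "j \<in> {..<n}"
    then have j: "j \<le> n" by simp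
    have "\<bar>g j\<bar> \<le> (\<Sum>r\<le>m. \<bar>a r\<bar> * (2 * real n / q ^ (m + 2) * (real n ^ r / fact r)))"
      unfolding g_def
    proof (intro order.trans[OF sum_abs] sum_mono)
      fix r assume "r \<in> {..m}"
      then have r: "r \<le> m" by simp
      \<comment> \<open>This is the weight of index \<open>r\<close> times \<open>n\<close>; it
        bounds both binomial coefficients once \<open>fact (Suc r)\<close> is weakened to
        \<open>fact r\<close>. As \<open>q \<le> 1\<close>, both denominators are then replaced by
        the smaller \<open>q ^ (m + 2)\<close>.\<close>
      define B where "B = real n * (real n ^ r / fact r)"
      have "real (n choose Suc r) \<le> real n ^ Suc r / fact (Suc r)"
        by (rule binomial_le_power_div_fact)
      also have "\<dots> \<le> real n ^ Suc r / fact r"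
        by (intro divide_left_mono mult_pos_pos fact_gt_zero fact_mono) auto
      finally have nB: "real (n choose Suc r) \<le> B" by (simp add: B_def)
      have "real (j choose Suc r) \<le> real (n choose Suc r)"
        using j by (simp add: binomial_right_mono)
      with nB have jB: "real (j choose Suc r) \<le> B" by linarith
      have "q ^ (m + 2) \<le> q" using q power_decreasing[of 1 "m + 2" q] by simp
      then have "real (n choose Suc r) / q \<le> B / q ^ (m + 2)"
        using nB q by (intro frac_le) auto
      moreover have "q ^ (m + 2) \<le> q ^ (r + 2)" using q r by (intro power_decreasing) auto
      then have "real (j choose Suc r) / q ^ (r + 2) \<le> B / q ^ (m + 2)"
        using jB q by (intro frac_le) auto
      ultimately have "\<bar>real (n choose Suc r) / q - real (j choose Suc r) / q ^ (r + 2)\<bar> \<le>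
          B / q ^ (m + 2) + B / q ^ (m + 2)"
        using q by (intro order.trans[OF abs_triangle_ineq4] add_mono) auto
      also have "\<dots> = 2 * real n / q ^ (m + 2) * (real n ^ r / fact r)"
        by (simp add: B_def mult_ac)
      finally show "\<bar>a r * (real (n choose Suc r) / q - real (j choose Suc r) / q ^ (r + 2))\<bar> \<le>
          \<bar>a r\<bar> * (2 * real n / q ^ (m + 2) * (real n ^ r / fact r))"
        unfolding abs_mult by (intro mult_left_mono) auto
    qed
    also have "\<dots> = 2 * real n / q ^ (m + 2) * binomial_weight n a m"
      by (simp only: binomial_weight_def sum_distrib_left mult.left_commute)
    finally have "\<bar>g j\<bar> * \<bar>E j\<bar> \<le> 2 * real n / q ^ (m + 2) * binomial_weight n a m * \<bar>E j\<bar>"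
      by (intro mult_right_mono) auto
    then show "g j * E j \<le> 2 * real n / q ^ (m + 2) * binomial_weight n a m * \<bar>E j\<bar>"
      by (metis abs_ge_self abs_mult order.trans)
  qed
  finally show ?thesis
    by (simp only: E_def l1_norm_def sum_distrib_left)
qed

text \<open>For \<open>m > 0\<close> the hypothesis forces \<open>n \<ge> 2\<close>, whence
  \<open>4 * n \<le> n ^ 3\<close>. The remaining factor 2 is absorbed by
  \<open>exp 1\<close>.\<close>

lemma dual_weight_le:
  assumes "Suc m \<le> n"
  shows "2 * real n * (4 * real n) ^ m \<le> exp 1 * real n ^ (3 * Suc m)"
proof -
  have e: "2 \<le> exp (1::real)" using exp_ge_add_one_self[of 1] by simp
  have n1: "1 \<le> real n" using assms by simp
  have "(4 * real n) ^ m \<le> (real n ^ 3) ^ m"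
  proof (cases "m = 0")
    case False
    then have "2 \<le> real n" using assms by linarith
    then have "4 \<le> real n * real n" using mult_mono[of 2 "real n" 2 "real n"] by simp
    then have "4 * real n \<le> real n ^ 3"
      using n1 mult_right_mono[of 4 "real n * real n" "real n"] by (simp add: power3_eq_cube)
    then show ?thesis by (intro power_mono) auto
  qed simp
  moreover have e3: "2 * real n \<le> exp 1 * real n ^ 3"
    using mult_mono[OF e power_increasing[of 1 3 "real n"]] n1 by simp
  ultimately have "2 * real n * (4 * real n) ^ m \<le> exp 1 * real n ^ 3 * (real n ^ 3) ^ m"
    by (intro mult_mono[OF e3]) simp_all
  then show ?thesis by (simp add: power_mult power_add)
qed

section \<open>The lower bound on the distance of mean traces\<close>

theorem theorem10:
  fixes p q :: real and n d :: nat
    and x y :: "bool list" and xs ys :: "bool list list" and l :: "nat \<Rightarrow> nat"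
  assumes "0 < p" and "p < 1" and "q = 1 - p"
    and "1 \<le> d"
    and "length x = n" and "length y = n" and "x \<noteq> y"
    and "length xs = d" and "length ys = d"
    and "x = concat xs" and "y = concat ys"
    and "\<And>i. i < d \<Longrightarrow> 0 < l i \<and> length (xs ! i) = l i \<and> length (ys ! i) = l i"
    and "\<And>i. i < d \<Longrightarrow> block_pair (xs ! i) (ys ! i)"
  shows "l1_norm n (\<lambda>j. mean_trace p x j - mean_trace p y j)
           \<ge> q / exp 1 * (q / real n) ^ (3 * d)"
proof -
  have q: "0 < q" "q \<le> 1" using assms(1-3) by auto
  obtain m where m: "d = Suc m" using assms(4) by (cases d) auto
  define c where "c = (\<lambda>i. length (concat (take i xs)))"
  define A where "A = prefix_diff x y"
  define N where "N = l1_norm n (\<lambda>j. mean_trace p x j - mean_trace p y j)"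
  have c_Suc: "c (Suc i) = c i + length (xs ! i)" if "i < d" for i
    using that assms(8) by (simp add: c_def take_Suc_conv_app_nth)
  \<comment> \<open>\<open>take\<close> saturates, so the boundaries stay at \<open>n\<close> from
    index \<open>d\<close> on and \<open>c\<close> is monotone on all naturals.\<close>
  have c_stop: "c i = n" if "d \<le> i" for i
    using that assms by (simp add: c_def)
  have "c i \<le> c (Suc i)" for i
    using c_Suc[of i] c_stop[of i] c_stop[of "Suc i"] by (cases "i < d") auto
  then have mono: "mono c" by (simp add: mono_iff_le_Suc)
  have c_le: "c i \<le> n" for i
    using monoD[OF mono, of i "max i d"] c_stop[of "max i d"] by simp
  \<comment> \<open>Nonempty blocks make the boundaries grow by at least 1 each, which gives
    \<open>d \<le> n\<close>.\<close>
  have "i \<le> c i" if "i \<le> d" for i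
    using that
  proof (induction i)
    case (Suc i)
    then show ?case using c_Suc[of i] assms(12)[of i] by simp
  qed simp
  then have dn: "d \<le> n" using c_stop[of d] by force
  \<comment> \<open>Indices from \<open>d\<close> on get an arbitrary sign, so that one total
    function \<open>s\<close> can be chosen.\<close>
  have "\<forall>i. \<exists>s::real. (s = 1 \<or> s = - 1) \<and>
      (i < d \<longrightarrow> (\<forall>k\<ge>c i. k < c (Suc i) \<longrightarrow> s * real_of_int (A (Suc k)) \<ge> 0))"
  proof
    fix i
    show "\<exists>s::real. (s = 1 \<or> s = - 1) \<and>
        (i < d \<longrightarrow> (\<forall>k\<ge>c i. k < c (Suc i) \<longrightarrow> s * real_of_int (A (Suc k)) \<ge> 0))"
    proof (cases "i < d")
      case True
      then show ?thesis
        using prefix_diff_concat_sign[of xs ys i] assms by (simp add: A_def c_def)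
    qed auto
  qed
  then obtain s :: "nat \<Rightarrow> real" where s: "\<And>i. s i = 1 \<or> s i = - 1"
    and sA: "\<And>i k. i < d \<Longrightarrow> c i \<le> k \<Longrightarrow> k < c (Suc i) \<Longrightarrow> s i * real_of_int (A (Suc k)) \<ge> 0"
    by metis
  obtain a where w: "binomial_weight n a m \<le> (4 * real n) ^ m"
    and a: "\<And>i k. i \<le> m \<Longrightarrow> c i \<le> k \<Longrightarrow> (i < m \<longrightarrow> k < c (Suc i)) \<Longrightarrow> s i * binomial_poly a m k \<ge> 1"
    using exists_binomial_poly_signs[of c n m s, OF mono c_le _ s] dn m by auto
  have ge_abs: "binomial_poly a m k * real_of_int (A (Suc k)) \<ge> \<bar>real_of_int (A (Suc k))\<bar>"
    if "k < n" for k
  proof -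
    \<comment> \<open>The index of the block that contains position \<open>k\<close>.\<close>
    define i where "i = (LEAST i. k < c (Suc i))"
    have ex: "k < c (Suc m)" using that c_stop[of d] m by simp
    have ki: "k < c (Suc i)" unfolding i_def using ex by (rule LeastI)
    have im: "i \<le> m" unfolding i_def using ex by (rule Least_le)
    have "c i \<le> k"
    proof (cases i)
      case 0
      then show ?thesis by (simp add: c_def)
    next
      case (Suc j)
      then show ?thesis using not_less_Least[of j "\<lambda>i. k < c (Suc i)"] by (simp add: i_def)
    qed
    then have "s i * binomial_poly a m k \<ge> 1" "s i * real_of_int (A (Suc k)) \<ge> 0"
      using a[of i k] sA[of i k] im ki m by auto
    \<comment> \<open>On the right the two signs cancel because \<open>s i\<close> squares to 1; on
      the left \<open>s i\<close> turns the prefix sum into its absolute value.\<close>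
    then have "1 * (s i * real_of_int (A (Suc k))) \<le>
        (s i * binomial_poly a m k) * (s i * real_of_int (A (Suc k)))"
      by (intro mult_right_mono)
    then show ?thesis
      using s[of i] \<open>s i * real_of_int (A (Suc k)) \<ge> 0\<close> by auto
  qed
  obtain k where k: "k < n" "A (Suc k) \<noteq> 0"
    using prefix_diff_nonzero[OF assms(5-7)] by (auto simp: A_def)
  have "1 \<le> \<bar>real_of_int (A (Suc k))\<bar>" using k(2) by linarith
  also have "\<dots> \<le> binomial_poly a m k * real_of_int (A (Suc k))" by (rule ge_abs[OF k(1)])
  also have "\<dots> \<le> (\<Sum>j<n. binomial_poly a m j * real_of_int (A (Suc j)))"
    using k(1) ge_abs by (intro member_le_sum) (auto intro: order.trans[OF abs_ge_zero])
  also have "\<dots> \<le> 2 * real n / q ^ (m + 2) * binomial_weight n a m * N"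
    unfolding A_def N_def assms(3) using assms by (intro prefix_pairing_le_l1_norm) auto
  also have "\<dots> \<le> 2 * real n / q ^ (m + 2) * (4 * real n) ^ m * N"
    using w q by (intro mult_right_mono mult_left_mono) (auto simp: N_def l1_norm_def sum_nonneg)
  also have "\<dots> = 2 * real n * (4 * real n) ^ m * N / q ^ (m + 2)"
    by simp
  finally have "q ^ (m + 2) \<le> 2 * real n * (4 * real n) ^ m * N"
    using q by (simp add: pos_le_divide_eq)
  also have "\<dots> \<le> exp 1 * real n ^ (3 * d) * N"
    using dual_weight_le[of m n] dn m
    by (intro mult_right_mono) (auto simp: N_def l1_norm_def sum_nonneg)
  finally have "q ^ (m + 2) \<le> exp 1 * real n ^ (3 * d) * N" .
  \<comment> \<open>Here \<open>m + 2 = d + 1\<close>, and the exponent may grow to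
    \<open>3 * d + 1\<close> because \<open>q \<le> 1\<close>.\<close>
  moreover have "q * q ^ (3 * d) \<le> q ^ (m + 2)"
    using q m by (simp only: flip: power_Suc) (intro power_decreasing, auto)
  ultimately have "q * q ^ (3 * d) \<le> exp 1 * real n ^ (3 * d) * N" by linarith
  moreover have "0 < real n" using dn m by simp
  ultimately have "q / exp 1 * (q / real n) ^ (3 * d) \<le> N"
    by (simp add: power_divide divide_simps mult.commute mult.left_commute)
  then show ?thesis by (simp only: N_def)
qed

end
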